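(* For every integer $n\geq 1$, let $\pi_{0,n}=[n\,(n-1)\,\cdots\,2\,1]\in \mathrm{I}_n$ be the longest permutation. Then $$W(\pi_{0,n})=\mathrm{D}_n .$$ That is, a permutation $w\in \mathrm{S}_n$ satisfies $w\cdot e=\pi_{0,n}$ and $\ell(w)=\ell_{(n)}(\pi_{0,n})$ if and only if $w\in\mathrm{D}_n$.
   Context: $\mathrm{S}_n$ is the symmetric group on $[n]=\{1,\dots,n\}$; a permutation $w$ is written in one-line notation $[w(1)\,w(2)\cdots w(n)]$, and cycles are written in parentheses. Products are compositions, $(uv)(x)=u(v(x))$. For $1\le i\le n-1$, $s_i=(i,i+1)$ is the simple transposition. $\mathrm{I}_n$ denotes the set of involutions ($w^2=\mathrm{id}$) in $\mathrm{S}_n$, and $e=[1\,2\cdots n]$ is the identity. $\ell(w)=\#\{(a,b): a<b,\ w(a)>w(b)\}$ is the number of inversions, $\mathrm{exc}(w)=\#\{a: w(a)>a\}$, and for $\pi\in\mathrm{I}_n$, $\ell_{(n)}(\pi)=\frac{\ell(\pi)+\mathrm{exc}(\pi)}{2}$. Action of simple transpositions on involutions: for $\pi\in\mathrm{I}_n$ and $1\le i\le n-1$, set $s_i\cdot\pi=\pi$ if $\pi^{-1}(i+1)<\pi^{-1}(i)$; $s_i\cdot\pi=s_i\pi$ if $\pi(i)=i$ and $\pi(i+1)=i+1$; and $s_i\cdot\pi=s_i\pi s_i$ otherwise. This operation satisfies $s_i\cdot(s_i\cdot\pi)=s_i\cdot\pi$, $s_i\cdot(s_j\cdot\pi)=s_j\cdot(s_i\cdot\pi)$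 for $|i-j|>1$, and $s_i\cdot(s_{i+1}\cdot(s_i\cdot\pi))=s_{i+1}\cdot(s_i\cdot(s_{i+1}\cdot\pi))$; hence for $w\in\mathrm{S}_n$ with any reduced expression $w=s_{i_1}s_{i_2}\cdots s_{i_k}$, $w\cdot\pi:=s_{i_1}\cdot(s_{i_2}\cdot(\cdots(s_{i_k}\cdot\pi)))$ is well defined. The $W$-set of $\pi\in\mathrm{I}_n$ is $W(\pi)=\{w\in\mathrm{S}_n: w\cdot e=\pi \text{ and } \ell(w)=\ell_{(n)}(\pi)\}$. $\mathrm{D}_n$ is the set of $w\in\mathrm{S}_n$ such that for every integer $i$ with $1\le i\le n/2$: $w^{-1}(n+1-i)<w^{-1}(i)$, and there is no $j$ with $i<j<n+1-i$ and $w^{-1}(n+1-i)<w^{-1}(j)<w^{-1}(i)$. (In one-line notation: $n+1-i$ appears before $i$, and no value strictly between $i$ and $n+1-i$ appears between them.) *)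

theory Defs
  imports Complex_Main "HOL-Combinatorics.Permutations"
begin

(* S_n is the set of functions w :: nat => nat with w permutes {1..n}; such functions are
   the identity outside {1..n}. Products are compositions. *)

definition involutions :: "nat \<Rightarrow> (nat \<Rightarrow> nat) set" where
  "involutions n = {w. w permutes {1..n} \<and> w \<circ> w = id}"

abbreviation simple :: "nat \<Rightarrow> nat \<Rightarrow> nat" where
  "simple i \<equiv> transpose i (i + 1)"

definition inversions :: "nat \<Rightarrow> (nat \<Rightarrow> nat) \<Rightarrow> nat" where
  "inversions n w = card {(a, b). a \<in> {1..n} \<and> b \<in> {1..n} \<and> a < b \<and> w a > w b}"

definition exc :: "nat \<Rightarrow> (nat \<Rightarrow> nat) \<Rightarrow> nat" where
  "exc n w = card {a \<in> {1..n}. w a > a}"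

definition inv_length :: "nat \<Rightarrow> (nat \<Rightarrow> nat) \<Rightarrow> real" where
  "inv_length n \<pi> = (real (inversions n \<pi>) + real (exc n \<pi>)) / 2"

definition simple_act :: "nat \<Rightarrow> (nat \<Rightarrow> nat) \<Rightarrow> (nat \<Rightarrow> nat)" where
  "simple_act i \<pi> =
     (if inv \<pi> (i + 1) < inv \<pi> i then \<pi>
      else if \<pi> i = i \<and> \<pi> (i + 1) = i + 1 then simple i \<circ> \<pi>
      else simple i \<circ> \<pi> \<circ> simple i)"

definition word_prod :: "nat list \<Rightarrow> (nat \<Rightarrow> nat)" where
  "word_prod is = foldr (\<lambda>i u. simple i \<circ> u) is id"

definition is_expression :: "nat \<Rightarrow> nat list \<Rightarrow> (nat \<Rightarrow> nat) \<Rightarrow> bool" where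
  "is_expression n is w \<longleftrightarrow> set is \<subseteq> {1..<n} \<and> word_prod is = w"

definition is_reduced_expression :: "nat \<Rightarrow> nat list \<Rightarrow> (nat \<Rightarrow> nat) \<Rightarrow> bool" where
  "is_reduced_expression n is w \<longleftrightarrow>
     is_expression n is w \<and> (\<forall>js. is_expression n js w \<longrightarrow> length is \<le> length js)"

(* Every w in S_n has a reduced expression, and by the idempotence, commutation and braid
   relations satisfied by simple_act the result does not depend on which one is chosen. *)
definition perm_act :: "nat \<Rightarrow> (nat \<Rightarrow> nat) \<Rightarrow> (nat \<Rightarrow> nat) \<Rightarrow> (nat \<Rightarrow> nat)" where
  "perm_act n w \<pi> = foldr simple_act (SOME is. is_reduced_expression n is w) \<pi>"

definition W_set :: "nat \<Rightarrow> (nat \<Rightarrow> nat) \<Rightarrow> (nat \<Rightarrow> nat) set" where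
  "W_set n \<pi> =
     {w. w permutes {1..n} \<and> perm_act n w id = \<pi> \<and> real (inversions n w) = inv_length n \<pi>}"

definition longest_perm :: "nat \<Rightarrow> nat \<Rightarrow> nat" where
  "longest_perm n a = (if a \<in> {1..n} then n + 1 - a else a)"

definition D_set :: "nat \<Rightarrow> (nat \<Rightarrow> nat) set" where
  "D_set n =
     {w. w permutes {1..n} \<and>
         (\<forall>i. 1 \<le> i \<and> 2 * i \<le> n \<longrightarrow>
            inv w (n + 1 - i) < inv w i \<and>
            \<not> (\<exists>j. i < j \<and> j < n + 1 - i \<and>
                   inv w (n + 1 - i) < inv w j \<and> inv w j < inv w i))}"

lemma longest_perm_involution: "longest_perm n \<in> involutions n"
proof -
  have inv: "longest_perm n \<circ> longest_perm n = id"
    by (auto simp: longest_perm_def fun_eq_iff)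
  then have "bij (longest_perm n)"
    using o_bij by blast
  then have "longest_perm n permutes {1..n}"
    unfolding permutes_def bij_iff by (auto simp: longest_perm_def)
  with inv show ?thesis
    by (simp add: involutions_def)
qed

end

theory Submission
  imports Defs
begin

text \<open>
  Acting by \<open>s\<^sub>i\<close> on an involution raises inversions plus excedances by \<open>2\<close> or does nothing,
  so the length condition says that every letter of a reduced word acts nontrivially. Hence a
  description of the \<open>W\<close>-set of an arbitrary involution that is preserved, in both directions, by
  such steps can be proved by induction along a reduced word. The description compares the
  positions in \<open>w\<close> of the two elements of each cycle, and those of non-nested pairs of cycles.
  The cycles of the longest permutation are pairwise nested, and what remains for it is the
  defining condition of \<open>D_set\<close>.
\<close>

text \<open>Keeps \<open>i + 1\<close> and \<open>{1..n}\<close> from being rewritten with \<open>Suc\<close>.\<close>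

declare One_nat_def [simp del]

section \<open>Adjacent transpositions and inverses\<close>

text \<open>No value lies between \<open>i\<close> and \<open>i + 1\<close>, so exchanging them can
  reverse only their mutual comparison.\<close>

lemma simple_less_iff:
  "simple i x < simple i y \<longleftrightarrow> x < y \<and> \<not> (x = i \<and> y = i + 1) \<or> x = i + 1 \<and> y = i"
  by (auto simp: transpose_def)

lemma simple_permutes: "i \<in> {1..<n} \<Longrightarrow> simple i permutes {1..n}"
  by (rule permutes_swap_id) auto

lemma simple_comp_simple [simp]: "simple i \<circ> (simple i \<circ> w) = w" "w \<circ> simple i \<circ> simple i = w"
  by (simp_all add: fun_eq_iff)

lemma inv_simple_comp: "bij w \<Longrightarrow> inv (simple i \<circ> w) = inv w \<circ> simple i"
  by (simp add: o_inv_distrib)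

lemma inv_eq_self: "\<pi> \<circ> \<pi> = id \<Longrightarrow> inv \<pi> = \<pi>"
  using inv_unique_comp by blast

subsection \<open>Inversions and reduced words\<close>

lemma inversions_finite:
  fixes w :: "nat \<Rightarrow> nat"
  shows "finite {(a, b). a \<in> {1..n} \<and> b \<in> {1..n} \<and> a < b \<and> w a > w b}"
  by (rule finite_subset[of _ "{1..n} \<times> {1..n}"]) auto

lemma inversions_id [simp]: "inversions n id = 0"
proof -
  have "{(a, b). a \<in> {1..n} \<and> b \<in> {1..n} \<and> a < b \<and> id a > id b} = {}"
    by auto
  then show ?thesis
    by (simp only: inversions_def card.empty)
qed

text \<open>An inversion at positions \<open>a < b\<close> yields one of \<open>inv w\<close> at
  \<open>w b < w a\<close>, injectively. Applying the inequality to \<open>inv w\<close> as well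
  gives equality.\<close>

lemma inversions_inv_le:
  assumes w: "w permutes {1..n}"
  shows "inversions n w \<le> inversions n (inv w)"
  unfolding inversions_def
proof (rule card_inj_on_le[OF _ _ inversions_finite])
  show "inj_on (\<lambda>(a, b). (w b, w a)) {(a, b). a \<in> {1..n} \<and> b \<in> {1..n} \<and> a < b \<and> w b < w a}"
    using permutes_inj[OF w] by (auto simp: inj_on_def dest: injD)
  show "(\<lambda>(a, b). (w b, w a)) ` {(a, b). a \<in> {1..n} \<and> b \<in> {1..n} \<and> a < b \<and> w b < w a}
      \<subseteq> {(a, b). a \<in> {1..n} \<and> b \<in> {1..n} \<and> a < b \<and> inv w b < inv w a}"
    using permutes_in_image[OF w] permutes_inverses(2)[OF w] by auto
qed

lemma inversions_inv:
  assumes "w permutes {1..n}"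
  shows "inversions n (inv w) = inversions n w"
  using inversions_inv_le[OF assms] inversions_inv_le[OF permutes_inv[OF assms]]
  by (simp add: permutes_inv_inv[OF assms])

text \<open>Exchanging the values \<open>i\<close> and \<open>i + 1\<close> affects no other
  comparison, so the single new inversion sits at their two positions.\<close>

lemma inversions_simple_comp:
  assumes w: "w permutes {1..n}" and i: "i \<in> {1..<n}" and less: "inv w i < inv w (i + 1)"
  shows "inversions n (simple i \<circ> w) = inversions n w + 1"
proof -
  let ?I = "\<lambda>w. {(a, b). a \<in> {1..n} \<and> b \<in> {1..n} \<and> a < b \<and> w a > (w b :: nat)}"
  let ?p = "(inv w i, inv w (i + 1))"
  have eq: "w a = x \<longleftrightarrow> a = inv w x" for a x
    using permutes_inverses[OF w] by metis
  have mem: "inv w i \<in> {1..n}" "inv w (i + 1) \<in> {1..n}"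
    using i permutes_in_image[OF permutes_inv[OF w]] by auto
  have "(a, b) \<in> ?I (simple i \<circ> w) \<longleftrightarrow> (a, b) = ?p \<or> (a, b) \<in> ?I w" for a b
  proof -
    have "a < b \<Longrightarrow> \<not> (w b = i \<and> w a = i + 1)"
      using less by (auto simp only: eq)
    moreover have "w b = i + 1 \<and> w a = i \<longleftrightarrow> (a, b) = ?p"
      by (auto simp only: eq)
    moreover have "a \<in> {1..n} \<and> b \<in> {1..n} \<and> a < b" if "(a, b) = ?p"
      using that mem less by simp
    ultimately show ?thesis
      unfolding mem_Collect_eq case_prod_conv comp_apply simple_less_iff by blast
  qed
  then have "?I (simple i \<circ> w) = insert ?p (?I w)"
    by blast
  moreover have "?p \<notin> ?I w"
    by (simp add: permutes_inverses[OF w])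
  ultimately show ?thesis
    unfolding inversions_def using card_insert_disjoint[OF inversions_finite] by simp
qed

lemma inversions_simple_comp_desc:
  assumes w: "w permutes {1..n}" and i: "i \<in> {1..<n}" and less: "inv w (i + 1) < inv w i"
  shows "inversions n w = inversions n (simple i \<circ> w) + 1"
proof -
  have "inversions n (simple i \<circ> (simple i \<circ> w)) = inversions n (simple i \<circ> w) + 1"
    by (rule inversions_simple_comp[OF permutes_compose[OF w simple_permutes[OF i]] i])
      (use w less in \<open>simp add: inv_simple_comp permutes_bij\<close>)
  then show ?thesis by simp
qed

lemma inv_simple_linear:
  fixes w :: "nat \<Rightarrow> nat"
  assumes "w permutes {1..n}"
  shows "inv w i < inv w (i + 1) \<or> inv w (i + 1) < inv w i"
  using inj_eq[OF permutes_inj[OF permutes_inv[OF assms]], of i "i + 1"] by force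

section \<open>Words in simple transpositions and their lengths\<close>

lemma word_prod_simps [simp]: "word_prod [] = id" "word_prod (i # is) = simple i \<circ> word_prod is"
  by (simp_all add: word_prod_def)

lemma word_prod_permutes: "set is \<subseteq> {1..<n} \<Longrightarrow> word_prod is permutes {1..n}"
proof (induction "is")
  case Nil
  show ?case
    unfolding word_prod_simps by (rule permutes_id)
next
  case (Cons i "is")
  then have "word_prod is permutes {1..n}" "i \<in> {1..<n}"
    by auto
  then show ?case
    unfolding word_prod_simps by (intro permutes_compose simple_permutes)
qed

lemma inversions_word_prod_le: "set is \<subseteq> {1..<n} \<Longrightarrow> inversions n (word_prod is) \<le> length is"
proof (induction "is")
  case (Cons i "is")
  then have "word_prod is permutes {1..n}" "i \<in> {1..<n}"
    by (auto intro: word_prod_permutes)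
  moreover have "inversions n (word_prod is) \<le> length is"
    using Cons by simp
  ultimately show ?case
    using inv_simple_linear[of "word_prod is" n i] inversions_simple_comp[of "word_prod is" n i]
      inversions_simple_comp_desc[of "word_prod is" n i]
    unfolding word_prod_simps list.size by linarith
qed simp

text \<open>With ascents only, the inverse increases along \<open>{1..n}\<close> and so never drops
  below its argument; this forces a permutation to be the identity.\<close>

lemma no_descent_imp_id:
  fixes w :: "nat \<Rightarrow> nat"
  assumes w: "w permutes {1..n}" and asc: "\<And>i. i \<in> {1..<n} \<Longrightarrow> inv w i < inv w (i + 1)"
  shows "w = id"
proof -
  let ?u = "inv w"
  have u: "?u permutes {1..n}"
    using w by (rule permutes_inv)
  have ge: "a \<le> ?u a" if "a \<le> n" for a
    using that
  proof (induction a)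
    case (Suc a)
    show ?case
    \<comment> \<open>\<open>0\<close> lies outside the permuted set, so no ascent leads from
      \<open>0\<close> to \<open>1\<close>; there, membership of the image in \<open>{1..n}\<close>
      is used.\<close>
    proof (cases "a = 0")
      case True
      then show ?thesis
        using Suc.prems permutes_in_image[OF u, of 1] by (auto simp: One_nat_def)
    next
      case False
      then show ?thesis
        using Suc.IH Suc.prems asc[of a] by (simp add: One_nat_def)
    qed
  qed simp
  have "?u = id"
  proof (rule permutes_natset_ge[OF u])
    show "\<forall>i\<in>{1..n}. i \<le> ?u i" using ge by auto
  qed
  then show ?thesis
    using permutes_inv_inv[OF w] by simp
qed

text \<open>Sorting: removing a descent costs one letter and one inversion, until only the identity
  is left.\<close>

lemma short_expression_exists:
  assumes "w permutes {1..n}"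
  shows "\<exists>is. is_expression n is w \<and> length is = inversions n w"
  using assms
proof (induction "inversions n w" arbitrary: w rule: less_induct)
  case less
  show ?case
  proof (cases "\<exists>i\<in>{1..<n}. inv w (i + 1) < inv w i")
    case True
    then obtain i where i: "i \<in> {1..<n}" "inv w (i + 1) < inv w i" by blast
    let ?v = "simple i \<circ> w"
    have v: "?v permutes {1..n}"
      using less.prems i by (intro permutes_compose simple_permutes)
    note eq = inversions_simple_comp_desc[OF less.prems i]
    from eq v less.hyps[of ?v] obtain "is" where "is_expression n is ?v" "length is = inversions n ?v"
      by auto
    with eq i show ?thesis
      by (intro exI[of _ "i # is"]) (auto simp: is_expression_def)
  next
    case False
    then have "w = id"
      using no_descent_imp_id[OF less.prems] inv_simple_linear[OF less.prems] by metis
    then show ?thesis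
      by (intro exI[of _ "[]"]) (simp add: is_expression_def)
  qed
qed

lemma reduced_expression_iff:
  assumes "w permutes {1..n}"
  shows "is_reduced_expression n is w \<longleftrightarrow> is_expression n is w \<and> length is = inversions n w"
proof -
  have le: "inversions n w \<le> length js" if "is_expression n js w" for js
    using that inversions_word_prod_le by (auto simp: is_expression_def)
  obtain ks where "is_expression n ks w" "length ks = inversions n w"
    using short_expression_exists[OF assms] by blast
  with le show ?thesis
    unfolding is_reduced_expression_def by (metis le_antisym)
qed

text \<open>If the first letter met a descent, the product of the tail would have more inversions
  than the tail has letters.\<close>

lemma reduced_Cons:
  assumes s: "set (i # is) \<subseteq> {1..<n}"
    and len: "length (i # is) = inversions n (word_prod (i # is))"
  shows "length is = inversions n (word_prod is)"
    and "inv (word_prod is) i < inv (word_prod is) (i + 1)"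
proof -
  have p: "word_prod is permutes {1..n}" and i: "i \<in> {1..<n}"
    using s by (auto intro: word_prod_permutes)
  have le: "inversions n (word_prod is) \<le> length is"
    using s by (auto intro: inversions_word_prod_le)
  show less: "inv (word_prod is) i < inv (word_prod is) (i + 1)"
    using inv_simple_linear[OF p, of i] inversions_simple_comp_desc[OF p i] le len by auto
  show "length is = inversions n (word_prod is)"
    using inversions_simple_comp[OF p i less] len by simp
qed

subsection \<open>The action on involutions\<close>

lemma simple_act_eq:
  assumes "\<pi> \<circ> \<pi> = id"
  shows "simple_act i \<pi> = (if \<pi> (i + 1) < \<pi> i then \<pi>
      else if \<pi> i = i \<and> \<pi> (i + 1) = i + 1 then simple i \<circ> \<pi>
      else simple i \<circ> \<pi> \<circ> simple i)"
  by (simp add: simple_act_def inv_eq_self[OF assms])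

lemma involution_simple_comp:
  assumes "\<pi> \<circ> \<pi> = id" "\<pi> i = i" "\<pi> (i + 1) = i + 1"
  shows "(simple i \<circ> \<pi>) \<circ> (simple i \<circ> \<pi>) = id"
proof
  fix x
  have "\<pi> (\<pi> x) = x" for x
    using assms(1) by (simp add: fun_eq_iff)
  then show "((simple i \<circ> \<pi>) \<circ> (simple i \<circ> \<pi>)) x = id x"
    using assms(2,3) by (simp add: transpose_def) metis
qed

lemma involution_conj:
  assumes "\<pi> \<circ> \<pi> = id"
  shows "(simple i \<circ> \<pi> \<circ> simple i) \<circ> (simple i \<circ> \<pi> \<circ> simple i) = id"
  using assms by (simp add: fun_eq_iff)

lemma simple_act_involutions:
  assumes "\<pi> \<in> involutions n" "i \<in> {1..<n}"
  shows "simple_act i \<pi> \<in> involutions n"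
proof -
  have \<pi>: "\<pi> permutes {1..n}" "\<pi> \<circ> \<pi> = id"
    using assms by (auto simp: involutions_def)
  have "simple i \<circ> \<pi> permutes {1..n}" "simple i \<circ> \<pi> \<circ> simple i permutes {1..n}"
    using \<pi>(1) assms(2) by (auto intro!: permutes_compose simple_permutes)
  then show ?thesis
    unfolding involutions_def simple_act_eq[OF \<pi>(2)]
    using \<pi> involution_conj[OF \<pi>(2)] involution_simple_comp[OF \<pi>(2)] by auto
qed

text \<open>At the word picked by \<open>SOME\<close> this is \<open>perm_act\<close> applied to
  \<open>id\<close>; as a function of the list it permits induction on letters.\<close>

definition word_act :: "nat list \<Rightarrow> nat \<Rightarrow> nat" where
  "word_act is = foldr simple_act is id"

lemma word_act_simps [simp]:
  "word_act [] = id" "word_act (i # is) = simple_act i (word_act is)"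
  by (simp_all only: word_act_def foldr.simps comp_apply id_apply)

lemma word_act_involutions: "set is \<subseteq> {1..<n} \<Longrightarrow> word_act is \<in> involutions n"
proof (induction "is")
  case Nil
  have "id permutes {1..n}" "id \<circ> id = id"
    by (simp_all only: permutes_id id_o)
  then show ?case
    unfolding involutions_def word_act_simps by blast
next
  case (Cons i "is")
  then have "word_act is \<in> involutions n" "i \<in> {1..<n}"
    by auto
  then show ?case
    unfolding word_act_simps by (intro simple_act_involutions)
qed

section \<open>Excedances and weight under one letter\<close>

text \<open>The two fixed points become a 2-cycle, whose smaller element \<open>i\<close> is the one
  new excedance.\<close>

lemma exc_simple_comp:
  assumes "\<pi> i = i" "\<pi> (i + 1) = i + 1" "\<pi> \<circ> \<pi> = id" "i \<in> {1..<n}"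
  shows "exc n (simple i \<circ> \<pi>) = exc n \<pi> + 1"
proof -
  have \<pi>\<pi>: "\<pi> (\<pi> x) = x" for x
    using assms(3) by (simp add: fun_eq_iff)
  have "{a \<in> {1..n}. a < (simple i \<circ> \<pi>) a} = insert i {a \<in> {1..n}. a < \<pi> a}"
  proof (rule set_eqI)
    fix a
    have "\<pi> a = i \<longleftrightarrow> a = i" "\<pi> a = i + 1 \<longleftrightarrow> a = i + 1"
      using \<pi>\<pi> assms(1,2) by metis+
    then show "a \<in> {a \<in> {1..n}. a < (simple i \<circ> \<pi>) a} \<longleftrightarrow> a \<in> insert i {a \<in> {1..n}. a < \<pi> a}"
      using assms by (auto simp: transpose_def)
  qed
  then show ?thesis
    using assms(1) by (simp add: exc_def)
qed

text \<open>Conjugation relabels the excedances; one could be lost or created only where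
  \<open>\<pi>\<close> sends one of \<open>i\<close>, \<open>i + 1\<close> to the other.\<close>

lemma exc_conj:
  assumes "\<pi> i \<noteq> i + 1" "\<pi> (i + 1) \<noteq> i" "i \<in> {1..<n}"
  shows "exc n (simple i \<circ> \<pi> \<circ> simple i) = exc n \<pi>"
proof -
  have "{a \<in> {1..n}. a < (simple i \<circ> \<pi> \<circ> simple i) a} = simple i ` {a \<in> {1..n}. a < \<pi> a}"
  proof (rule set_eqI)
    fix a
    have "a < (simple i \<circ> \<pi> \<circ> simple i) a \<longleftrightarrow> simple i (simple i a) < simple i (\<pi> (simple i a))"
      by simp
    also have "\<dots> \<longleftrightarrow> simple i a < \<pi> (simple i a)"
      unfolding simple_less_iff using assms(1,2) by auto
    finally show "a \<in> {a \<in> {1..n}. a < (simple i \<circ> \<pi> \<circ> simple i) a}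
        \<longleftrightarrow> a \<in> simple i ` {a \<in> {1..n}. a < \<pi> a}"
      unfolding in_transpose_image_iff mem_Collect_eq
        permutes_in_image[OF simple_permutes[OF assms(3)]] by blast
  qed
  then show ?thesis
    by (simp add: exc_def card_image)
qed

text \<open>Twice \<open>inv_length\<close>, kept in \<open>nat\<close>.\<close>

definition weight :: "nat \<Rightarrow> (nat \<Rightarrow> nat) \<Rightarrow> nat" where
  "weight n \<pi> = inversions n \<pi> + exc n \<pi>"

lemma weight_id [simp]: "weight n id = 0"
  by (simp add: weight_def exc_def)

text \<open>A new 2-cycle contributes one inversion and one excedance; a conjugation contributes two
  inversions, one from each side.\<close>

lemma weight_simple_act:
  assumes \<pi>: "\<pi> \<in> involutions n" and i: "i \<in> {1..<n}" and less: "\<pi> i < \<pi> (i + 1)"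
  shows "weight n (simple_act i \<pi>) = weight n \<pi> + 2"
proof -
  have perm: "\<pi> permutes {1..n}" and inv: "\<pi> \<circ> \<pi> = id"
    using \<pi> by (auto simp: involutions_def)
  have \<pi>\<pi>: "\<pi> (\<pi> x) = x" for x
    using inv by (simp add: fun_eq_iff)
  note inv_\<pi> = inv_eq_self[OF inv]
  have left: "inversions n (simple i \<circ> \<pi>) = inversions n \<pi> + 1"
    using inversions_simple_comp[OF perm i] less inv_\<pi> by simp
  show ?thesis
  proof (cases "\<pi> i = i \<and> \<pi> (i + 1) = i + 1")
    case True
    then show ?thesis
      using left exc_simple_comp[of \<pi> i n] inv i less by (simp add: weight_def simple_act_eq[OF inv])
  next
    case False
    have ne: "\<pi> i \<noteq> i + 1" "\<pi> (i + 1) \<noteq> i"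
      using \<pi>\<pi>[of i] \<pi>\<pi>[of "i + 1"] less by auto
    have inv_left: "inv (simple i \<circ> \<pi>) = \<pi> \<circ> simple i"
      using inv_simple_comp[OF permutes_bij[OF perm]] inv_\<pi> by simp
    have perm': "simple i \<circ> \<pi> permutes {1..n}"
      by (intro permutes_compose perm simple_permutes i)
    \<comment> \<open>Right multiplication is reduced to left multiplication by passing to the
      inverse, which has as many inversions.\<close>
    have right: "inversions n (\<pi> \<circ> simple i) = inversions n \<pi> + 1"
      using inversions_inv[OF perm'] left inv_left by simp
    have "inversions n (simple i \<circ> (\<pi> \<circ> simple i)) = inversions n (\<pi> \<circ> simple i) + 1"
    proof (rule inversions_simple_comp[OF _ i])
      show "\<pi> \<circ> simple i permutes {1..n}"
        by (intro permutes_compose perm simple_permutes i)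
      have "inv (\<pi> \<circ> simple i) = simple i \<circ> \<pi>"
        using inv_left permutes_inv_inv[OF perm'] by simp
      \<comment> \<open>This order could be reversed only if \<open>i\<close> and
        \<open>i + 1\<close> were both fixed, the case already treated.\<close>
      moreover have "simple i (\<pi> i) < simple i (\<pi> (i + 1))"
        unfolding simple_less_iff using less False by auto
      ultimately show "inv (\<pi> \<circ> simple i) i < inv (\<pi> \<circ> simple i) (i + 1)"
        by simp
    qed
    then show ?thesis
      using less right exc_conj[OF ne i]
      by (simp only: weight_def simple_act_eq[OF inv] comp_assoc False if_False) simp
  qed
qed

lemma simple_act_fixed:
  assumes "\<pi> \<in> involutions n" "\<not> \<pi> i < \<pi> (i + 1)"
  shows "simple_act i \<pi> = \<pi>"
proof -
  have "\<pi> i \<noteq> \<pi> (i + 1)"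
    using assms(1) permutes_inj[THEN injD, of \<pi> "{1..n}" i "i + 1"] by (auto simp: involutions_def)
  with assms show ?thesis
    by (auto simp: involutions_def simple_act_eq)
qed

text \<open>Each letter adds 0 or 2, so equality is possible only if every letter acts
  nontrivially.\<close>

lemma weight_word_act_le:
  "set is \<subseteq> {1..<n} \<Longrightarrow> weight n (word_act is) \<le> 2 * length is"
proof (induction "is")
  case Nil
  show ?case
    unfolding word_act_simps weight_id by simp
next
  case (Cons i "is")
  have inv: "word_act is \<in> involutions n" and i: "i \<in> {1..<n}"
    using Cons.prems by (simp_all add: word_act_involutions)
  show ?case
  proof (cases "word_act is i < word_act is (i + 1)")
    case True
    show ?thesis
      using Cons weight_simple_act[OF inv i True] unfolding word_act_simps by simp
  next
    case False
    show ?thesis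
      using Cons simple_act_fixed[OF inv False] unfolding word_act_simps by simp
  qed
qed

subsection \<open>Atoms\<close>

text \<open>The function \<open>u\<close> is the inverse of \<open>w\<close>, that is, \<open>u x\<close> is the position of the value \<open>x\<close>. A pair
  \<open>a \<le> \<pi> a\<close> stands for a cycle of \<open>\<pi>\<close>, including fixed points.\<close>

definition atom :: "(nat \<Rightarrow> nat) \<Rightarrow> (nat \<Rightarrow> nat) \<Rightarrow> bool" where
  "atom \<pi> u \<longleftrightarrow>
     (\<forall>a. a < \<pi> a \<longrightarrow> u (\<pi> a) < u a) \<and>
     (\<forall>a t. a < t \<longrightarrow> t < \<pi> a \<longrightarrow> \<not> (u (\<pi> a) < u t \<and> u t < u a)) \<and>
     (\<forall>a b. a \<le> \<pi> a \<longrightarrow> b \<le> \<pi> b \<longrightarrow> a < b \<longrightarrow> \<pi> a < \<pi> b \<longrightarrow> u a < u (\<pi> b))"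

lemma atomD:
  assumes "atom \<pi> u"
  shows "a < \<pi> a \<Longrightarrow> u (\<pi> a) < u a"
    and "a < t \<Longrightarrow> t < \<pi> a \<Longrightarrow> u (\<pi> a) < u t \<Longrightarrow> u t < u a \<Longrightarrow> False"
    and "a \<le> \<pi> a \<Longrightarrow> b \<le> \<pi> b \<Longrightarrow> a < b \<Longrightarrow> \<pi> a < \<pi> b \<Longrightarrow> u a < u (\<pi> b)"
  using assms unfolding atom_def by blast+

section \<open>Atoms under one letter\<close>

text \<open>The third clause of \<open>atom\<close> for the cycles of \<open>i\<close> and
  \<open>i + 1\<close> gives the strict comparison, the first clause the other two. Chained, they
  show that an ascent of \<open>\<pi>\<close> forces one of \<open>u\<close>.\<close>

lemma atom_ascent:
  assumes at: "atom \<pi> u" and inv: "\<pi> \<circ> \<pi> = id" and less: "\<pi> i < \<pi> (i + 1)"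
  shows "u (min i (\<pi> i)) < u (max (i + 1) (\<pi> (i + 1)))"
    and "u i \<le> u (min i (\<pi> i))"
    and "u (max (i + 1) (\<pi> (i + 1))) \<le> u (i + 1)"
proof -
  have \<pi>\<pi>: "\<pi> (\<pi> x) = x" for x
    using inv by (simp add: fun_eq_iff)
  have mm: "\<pi> (min x (\<pi> x)) = max x (\<pi> x)" for x
    by (auto simp: min_def max_def \<pi>\<pi>)
  show "u (min i (\<pi> i)) < u (max (i + 1) (\<pi> (i + 1)))"
    using atomD(3)[OF at, of "min i (\<pi> i)" "min (i + 1) (\<pi> (i + 1))"] less
    unfolding mm by (auto simp: less_max_iff_disj min_less_iff_disj min_def max_def split: if_splits)
  show "u i \<le> u (min i (\<pi> i))"
    using atomD(1)[OF at, of "\<pi> i"] by (auto simp: min_def \<pi>\<pi>)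
  show "u (max (i + 1) (\<pi> (i + 1))) \<le> u (i + 1)"
    using atomD(1)[OF at, of "i + 1"] by (cases "\<pi> (i + 1) = i + 1") (auto simp: max_def)
qed

text \<open>Two fixed points are joined: \<open>less\<close> orients the new cycle, and its
  comparisons with other cycles are those the fixed points already had.\<close>

lemma atom_simple_comp_fixed:
  assumes inv: "\<pi> \<circ> \<pi> = id" and fixed: "\<pi> i = i" "\<pi> (i + 1) = i + 1"
    and at: "atom \<pi> u" and less: "u i < u (i + 1)"
  shows "atom (simple i \<circ> \<pi>) (u \<circ> simple i)"
proof -
  have \<pi>\<pi>: "\<pi> (\<pi> x) = x" for x
    using inv by (simp add: fun_eq_iff)
  have ne: "\<pi> x = i \<longleftrightarrow> x = i" "\<pi> x = i + 1 \<longleftrightarrow> x = i + 1" for x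
    using \<pi>\<pi> fixed by metis+
  define \<rho> v where "\<rho> = simple i \<circ> \<pi>" and "v = u \<circ> simple i"
  have vals: "\<rho> i = i + 1" "\<rho> (i + 1) = i" "v i = u (i + 1)" "v (i + 1) = u i"
    by (simp_all add: fixed \<rho>_def v_def)
  have other: "\<rho> x = \<pi> x" "v x = u x" "v (\<pi> x) = u (\<pi> x)" if "x \<noteq> i" "x \<noteq> i + 1" for x
    using that ne[of x] by (auto simp: transpose_def \<rho>_def v_def)
  show ?thesis
    unfolding atom_def \<rho>_def[symmetric] v_def[symmetric]
  proof (intro conjI allI impI)
    fix a assume "a < \<rho> a"
    then show "v (\<rho> a) < v a"
      using vals other[of a] less atomD(1)[OF at, of a] by (cases "a = i"; cases "a = i + 1") auto
  next
    fix a t assume a: "a < t" "t < \<rho> a"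
    then have "a \<noteq> i" "a \<noteq> i + 1"
      using vals by auto
    then show "\<not> (v (\<rho> a) < v t \<and> v t < v a)"
      using a other[of a] atomD(2)[OF at, of a "simple i t"] ne[of a]
      by (auto simp: v_def transpose_def split: if_splits)
  next
    fix a b assume ab: "a \<le> \<rho> a" "b \<le> \<rho> b" "a < b" "\<rho> a < \<rho> b"
    then have "a \<noteq> i + 1" "b \<noteq> i + 1"
      using vals by auto
    \<comment> \<open>As first cycle, the new pair inherits the bound of \<open>i + 1\<close>; as
      second cycle, that of \<open>i\<close>, because \<open>v\<close> exchanges their
      positions.\<close>
    then show "v a < v (\<rho> b)"
      using ab vals other[of a] other[of b] ne[of a] ne[of b] fixed
        atomD(3)[OF at, of a b] atomD(3)[OF at, of a i] atomD(3)[OF at, of "i + 1" b]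
      by (cases "a = i"; cases "b = i") auto
  qed
qed

text \<open>A cycle is split. The third clause bounds its later position \<open>u i\<close> from
  above and its earlier position \<open>u (i + 1)\<close> from below, so both new fixed points
  inherit both bounds.\<close>

lemma atom_simple_comp_swap:
  assumes inv: "\<pi> \<circ> \<pi> = id" and swap: "\<pi> i = i + 1"
    and at: "atom \<pi> u" and less: "u (i + 1) < u i"
  shows "atom (simple i \<circ> \<pi>) (u \<circ> simple i)"
proof -
  have \<pi>\<pi>: "\<pi> (\<pi> x) = x" for x
    using inv by (simp add: fun_eq_iff)
  have ne: "\<pi> x = i \<longleftrightarrow> x = i + 1" "\<pi> x = i + 1 \<longleftrightarrow> x = i" for x
    using \<pi>\<pi> swap by metis+
  have swap': "\<pi> (i + 1) = i"
    using \<pi>\<pi>[of i] swap by simp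
  define \<rho> v where "\<rho> = simple i \<circ> \<pi>" and "v = u \<circ> simple i"
  have vals: "\<rho> i = i" "\<rho> (i + 1) = i + 1" "v i = u (i + 1)" "v (i + 1) = u i"
    by (simp_all add: swap swap' \<rho>_def v_def)
  have other: "\<rho> x = \<pi> x" "v x = u x" "v (\<pi> x) = u (\<pi> x)" if "x \<noteq> i" "x \<noteq> i + 1" for x
    using that ne[of x] by (auto simp: transpose_def \<rho>_def v_def)
  show ?thesis
    unfolding atom_def \<rho>_def[symmetric] v_def[symmetric]
  proof (intro conjI allI impI)
    fix a assume "a < \<rho> a"
    then show "v (\<rho> a) < v a"
      using vals other[of a] less atomD(1)[OF at, of a] by (cases "a = i"; cases "a = i + 1") auto
  next
    fix a t assume a: "a < t" "t < \<rho> a"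
    then have "a \<noteq> i" "a \<noteq> i + 1"
      using vals by auto
    then show "\<not> (v (\<rho> a) < v t \<and> v t < v a)"
      using a other[of a] atomD(2)[OF at, of a "simple i t"] ne[of a]
      by (auto simp: v_def transpose_def split: if_splits)
  next
    fix a b assume ab: "a \<le> \<rho> a" "b \<le> \<rho> b" "a < b" "\<rho> a < \<rho> b"
    consider "a = i" "b = i + 1" | "a \<in> {i, i + 1}" "b \<notin> {i, i + 1}" | "a \<notin> {i, i + 1}" "b \<in> {i, i + 1}"
      | "a \<notin> {i, i + 1}" "b \<notin> {i, i + 1}"
      using ab(3) by auto
    then show "v a < v (\<rho> b)"
    proof cases
      case 1
      then show ?thesis using vals less by simp
    next
      case 2
      then have "u i < u (\<pi> b)"
        using ab vals other[of b] ne[of b] swap swap' atomD(3)[OF at, of i b] by auto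
      then show ?thesis
        using 2 vals other[of b] less by auto
    next
      case 3
      then have "u a < u (i + 1)"
        using ab vals other[of a] ne[of a] swap swap' atomD(3)[OF at, of a i] by auto
      then show ?thesis
        using 3 vals other[of a] less by auto
    next
      case 4
      then show ?thesis
        using ab other[of a] other[of b] atomD(3)[OF at, of a b] by auto
    qed
  qed
qed

text \<open>Conjugation by \<open>simple i\<close> relabels the cycles and their positions simultaneously, so only
  the comparisons between \<open>i\<close> and \<open>i + 1\<close> are affected.\<close>

lemma atom_conj:
  assumes at: "atom \<pi> u"
    and swap: "\<pi> i \<noteq> i + 1" "\<pi> (i + 1) \<noteq> i"
    and left: "\<And>b. \<pi> (i + 1) = b \<Longrightarrow> i + 1 < b \<Longrightarrow> \<not> (u b < u i \<and> u i < u (i + 1))"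
    and right: "\<And>a. \<pi> a = i \<Longrightarrow> a < i \<Longrightarrow> \<not> (u i < u (i + 1) \<and> u (i + 1) < u a)"
    and starts: "i + 1 \<le> \<pi> (i + 1) \<Longrightarrow> i \<le> \<pi> i \<Longrightarrow> simple i (\<pi> (i + 1)) < simple i (\<pi> i)
      \<Longrightarrow> u (i + 1) < u (\<pi> i)"
    and ends: "\<And>a b. \<pi> a = i + 1 \<Longrightarrow> \<pi> b = i \<Longrightarrow> a \<le> i + 1 \<Longrightarrow> b \<le> i \<Longrightarrow> a < b \<Longrightarrow> u a < u i"
  shows "atom (simple i \<circ> \<pi> \<circ> simple i) (u \<circ> simple i)"
proof -
  \<comment> \<open>\<open>simple i\<close> could reverse \<open>\<pi> a < a\<close> only if
    \<open>a\<close> and \<open>\<pi> a\<close> were \<open>i + 1\<close> and \<open>i\<close>,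
    which \<open>swap\<close> excludes.\<close>
  have le: "a \<le> \<pi> a" if "simple i a \<le> simple i (\<pi> a)" for a
    using that swap simple_less_iff[of i a "\<pi> a"] by (cases "a = \<pi> a")
      (auto simp: order.order_iff_strict dest: injD[OF inj_transpose])
  show ?thesis
    unfolding atom_def comp_apply
  proof (intro conjI allI impI, goal_cases)
    case (1 a)
    then have "simple i (simple i a) < simple i (\<pi> (simple i a))" by simp
    then have "simple i a < \<pi> (simple i a)"
      unfolding simple_less_iff using swap by auto
    then show ?case
      using atomD(1)[OF at] by simp
  next
    case (2 a t)
    define a' t' where "a' = simple i a" and "t' = simple i t"
    have "simple i a' < simple i t'" "simple i t' < simple i (\<pi> a')"
      using 2 by (simp_all add: a'_def t'_def)
    \<comment> \<open>Relabelling puts a new element strictly inside a cycle only if it is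
      \<open>i\<close> below a smaller end \<open>i + 1\<close>, or \<open>i + 1\<close> above a
      larger end \<open>i\<close>: these are \<open>left\<close> and \<open>right\<close>.\<close>
    then show ?case
      unfolding simple_less_iff a'_def[symmetric] t'_def[symmetric]
      using atomD(2)[OF at, of a' t'] left[of "\<pi> a'"] right[of a'] swap by auto
  next
    case (3 a b)
    define a' b' where "a' = simple i a" and "b' = simple i b"
    have "simple i a' \<le> simple i (\<pi> a')" "simple i b' \<le> simple i (\<pi> b')"
      and less: "simple i a' < simple i b'" "simple i (\<pi> a') < simple i (\<pi> b')"
      using 3 by (simp_all add: a'_def b'_def)
    then have le': "a' \<le> \<pi> a'" "b' \<le> \<pi> b'"
      using le by blast+
    have "u a' < u (\<pi> b')"
    \<comment> \<open>A new non-nested pair arises when the smaller elements \<open>i + 1\<close>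
      and \<open>i\<close> change order (\<open>starts\<close>) or the larger ones do
      (\<open>ends\<close>).\<close>
    proof (cases "a' = i + 1 \<and> b' = i")
      case True
      then show ?thesis
        using starts le' less by auto
    next
      case False
      then have "a' < b'" using less(1) unfolding simple_less_iff by auto
      then show ?thesis
        using atomD(3)[OF at, of a' b'] ends[of a' b'] le' less(2) unfolding simple_less_iff by auto
    qed
    then show ?case
      by (simp add: a'_def b'_def)
  qed
qed

text \<open>For a conjugation, \<open>atom_ascent\<close> excludes the patterns \<open>left\<close>
  and \<open>right\<close> of \<open>atom_conj\<close>; the situations of \<open>starts\<close> and
  \<open>ends\<close> cannot occur, as \<open>\<pi>\<close> ascends and does not fix both
  points.\<close>

lemma atom_simple_act:
  assumes \<pi>: "\<pi> \<circ> \<pi> = id" and at: "atom \<pi> u" and u: "u i < u (i + 1)" and less: "\<pi> i < \<pi> (i + 1)"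
  shows "atom (simple_act i \<pi>) (u \<circ> simple i)"
proof (cases "\<pi> i = i \<and> \<pi> (i + 1) = i + 1")
  case True
  then show ?thesis
    using atom_simple_comp_fixed[OF \<pi> _ _ at u] less by (simp add: simple_act_eq[OF \<pi>])
next
  case False
  have \<pi>\<pi>: "\<pi> (\<pi> x) = x" for x
    using \<pi> by (simp add: fun_eq_iff)
  note asc = atom_ascent[OF at \<pi> less]
  have "atom (simple i \<circ> \<pi> \<circ> simple i) (u \<circ> simple i)"
  proof (rule atom_conj[OF at])
    show "\<pi> i \<noteq> i + 1" "\<pi> (i + 1) \<noteq> i"
      using \<pi>\<pi>[of i] \<pi>\<pi>[of "i + 1"] less by auto
    show "\<not> (u b < u i \<and> u i < u (i + 1))" if "\<pi> (i + 1) = b" "i + 1 < b" for b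
      using asc that by (simp add: max_def)
    show "\<not> (u i < u (i + 1) \<and> u (i + 1) < u a)" if "\<pi> a = i" "a < i" for a
      using asc that \<pi>\<pi>[of a] by (simp add: min_def)
    show "u (i + 1) < u (\<pi> i)"
      if "i + 1 \<le> \<pi> (i + 1)" "i \<le> \<pi> i" "simple i (\<pi> (i + 1)) < simple i (\<pi> i)"
      using that less False unfolding simple_less_iff by auto
    show "u a < u i" if "\<pi> a = i + 1" "\<pi> b = i" "a < b" for a b
      using that less \<pi>\<pi>[of a] \<pi>\<pi>[of b] by simp
  qed
  then show ?thesis
    using less unfolding simple_act_eq[OF \<pi>] if_not_P[OF False] by simp
qed

text \<open>Undoes one letter. By \<open>atom_ascent\<close> a descent of \<open>u\<close> forces
  one of \<open>\<pi>\<close>; splitting the cycle of \<open>i\<close> and \<open>i + 1\<close>, or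
  else conjugating, turns it into an ascent.\<close>

lemma atom_descent:
  assumes \<pi>: "\<pi> \<in> involutions n" and i: "i \<in> {1..<n}" and at: "atom \<pi> u" and u: "u (i + 1) < u i"
    and u_inj: "inj u"
  obtains \<rho> where "\<rho> \<in> involutions n" "atom \<rho> (u \<circ> simple i)" "\<rho> i < \<rho> (i + 1)" "simple_act i \<rho> = \<pi>"
proof -
  have perm: "\<pi> permutes {1..n}" and inv: "\<pi> \<circ> \<pi> = id"
    using \<pi> by (auto simp: involutions_def)
  have \<pi>\<pi>: "\<pi> (\<pi> x) = x" for x
    using inv by (simp add: fun_eq_iff)
  have less: "\<pi> (i + 1) < \<pi> i"
  proof (cases "\<pi> i" "\<pi> (i + 1)" rule: linorder_cases)
    case less
    from atom_ascent[OF at inv less] u show ?thesis by linarith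
  next
    case equal
    then show ?thesis using \<pi>\<pi>[of i] \<pi>\<pi>[of "i + 1"] by simp
  qed
  show thesis
  proof (cases "\<pi> i = i + 1")
    case True
    let ?\<rho> = "simple i \<circ> \<pi>"
    have swap: "\<pi> (i + 1) = i"
      using \<pi>\<pi>[of i] True by simp
    have fixed: "?\<rho> i = i" "?\<rho> (i + 1) = i + 1"
      by (simp_all add: True swap)
    have "?\<rho> \<circ> ?\<rho> = id"
    proof
      fix x
      have "\<pi> x = i \<longleftrightarrow> x = i + 1" "\<pi> x = i + 1 \<longleftrightarrow> x = i"
        using \<pi>\<pi> True by metis+
      then show "(?\<rho> \<circ> ?\<rho>) x = id x"
        using True swap \<pi>\<pi>[of x] by (auto simp: transpose_def)
    qed
    moreover have "?\<rho> permutes {1..n}"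
      by (rule permutes_compose[OF perm simple_permutes[OF i]])
    ultimately show thesis
      using that[of ?\<rho>] atom_simple_comp_swap[OF inv True at u] fixed
      by (simp add: involutions_def simple_act_eq)
  next
    case False
    let ?\<rho> = "simple i \<circ> \<pi> \<circ> simple i"
    have \<rho>_less: "?\<rho> i < ?\<rho> (i + 1)"
      using less False by (simp add: simple_less_iff)
    have "?\<rho> \<in> involutions n"
      unfolding involutions_def
      using involution_conj[OF inv]
        permutes_compose[OF simple_permutes[OF i] permutes_compose[OF perm simple_permutes[OF i]]]
      by (simp add: comp_assoc)
    moreover have "atom ?\<rho> (u \<circ> simple i)"
    proof (rule atom_conj[OF at False])
      show "\<pi> (i + 1) \<noteq> i"
        using \<pi>\<pi>[of "i + 1"] False by auto
      show "\<not> (u b < u i \<and> u i < u (i + 1))" for b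
        using u by simp
      show "\<not> (u i < u (i + 1) \<and> u (i + 1) < u a)" for a
        using u by simp
      \<comment> \<open>Here \<open>i + 1\<close> lies inside the cycle of \<open>i\<close>. Its
        position precedes \<open>u i\<close> and cannot fall between the positions of the two ends,
        so it precedes both.\<close>
      show "u (i + 1) < u (\<pi> i)" if "i + 1 \<le> \<pi> (i + 1)"
      proof -
        have "u (i + 1) \<noteq> u (\<pi> i)"
          using that less injD[OF u_inj, of "i + 1" "\<pi> i"] by auto
        then show ?thesis
          using atomD(2)[OF at, of i "i + 1"] less that u by fastforce
      qed
      show "u a < u i" if "\<pi> a = i + 1" "\<pi> b = i" "b \<le> i" "a < b" for a b
        using atomD(2)[OF at, of a i] injD[OF u_inj, of a i] that u by fastforce
    qed
    moreover have "simple_act i ?\<rho> = \<pi>"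
    proof -
      have *: "\<not> (?\<rho> i = i \<and> ?\<rho> (i + 1) = i + 1)"
        using less by (auto simp: transpose_eq_iff)
      then show ?thesis
        unfolding simple_act_eq[OF involution_conj[OF inv]] if_not_P[OF *]
          if_not_P[OF less_not_sym[OF \<rho>_less]]
        by (simp add: comp_assoc)
    qed
    ultimately show thesis
      using that \<rho>_less by blast
  qed
qed

section \<open>The \<open>W\<close>-set as a set of atoms\<close>

text \<open>Removing the first letter changes the involution, so \<open>\<pi>\<close> is arbitrary
  in the induction: \<open>atom_descent\<close> goes back one letter, \<open>atom_simple_act\<close>
  forward.\<close>

lemma atom_iff_word_act:
  assumes "set is \<subseteq> {1..<n}" "length is = inversions n (word_prod is)" "\<pi> \<in> involutions n"
  shows "atom \<pi> (inv (word_prod is)) \<longleftrightarrow> word_act is = \<pi> \<and> weight n \<pi> = 2 * length is"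
  using assms
proof (induction "is" arbitrary: \<pi>)
  case Nil
  \<comment> \<open>With positions given by \<open>id\<close>, the first clause would put a larger
    element before a smaller one, so 2-cycles are impossible.\<close>
  have "\<pi> = id" if "atom \<pi> id"
  proof
    fix x
    have "\<pi> (\<pi> x) = x"
      using Nil.prems(3) by (auto simp: involutions_def fun_eq_iff)
    then show "\<pi> x = id x"
      using atomD(1)[OF that, of x] atomD(1)[OF that, of "\<pi> x"]
      by (cases x "\<pi> x" rule: linorder_cases) auto
  qed
  moreover have "atom id id"
    by (simp add: atom_def)
  ultimately have "atom \<pi> id \<longleftrightarrow> id = \<pi> \<and> weight n \<pi> = 2 * 0"
    using weight_id by fastforce
  then show ?case
    by (simp only: word_prod_simps word_act_simps inv_id list.size)
next
  case (Cons i "is")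
  let ?w = "word_prod is" and ?\<rho> = "word_act is"
  note red = reduced_Cons[OF Cons.prems(1,2)]
  have i: "i \<in> {1..<n}" and s: "set is \<subseteq> {1..<n}"
    using Cons.prems by auto
  have inv_w: "inv (word_prod (i # is)) = inv ?w \<circ> simple i"
    by (simp add: inv_simple_comp permutes_bij[OF word_prod_permutes[OF s]])
  have inj: "inj (inv ?w \<circ> simple i)"
    by (intro inj_compose inj_transpose permutes_inj[OF permutes_inv[OF word_prod_permutes[OF s]]])
  have \<rho>: "?\<rho> \<in> involutions n"
    by (rule word_act_involutions[OF s])
  note IH = Cons.IH[OF s red(1)]
  show ?case
  proof
    assume "atom \<pi> (inv (word_prod (i # is)))"
    then obtain \<sigma> where \<sigma>: "\<sigma> \<in> involutions n" "atom \<sigma> (inv ?w \<circ> simple i \<circ> simple i)"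
      "\<sigma> i < \<sigma> (i + 1)" "simple_act i \<sigma> = \<pi>"
      using atom_descent[OF Cons.prems(3) i _ _ inj] red(2) unfolding inv_w by auto
    then have "?\<rho> = \<sigma>" "weight n \<sigma> = 2 * length is"
      using IH[OF \<sigma>(1)] by simp_all
    then show "word_act (i # is) = \<pi> \<and> weight n \<pi> = 2 * length (i # is)"
      using weight_simple_act[OF \<sigma>(1) i \<sigma>(3)] \<sigma>(4) by simp
  next
    assume *: "word_act (i # is) = \<pi> \<and> weight n \<pi> = 2 * length (i # is)"
    have le: "weight n ?\<rho> \<le> 2 * length is"
      by (rule weight_word_act_le[OF s])
    \<comment> \<open>A trivial first letter would leave the weight at most
      \<open>2 * length is\<close>, short of the required value.\<close>
    have less: "?\<rho> i < ?\<rho> (i + 1)"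
      using * le simple_act_fixed[OF \<rho>, of i] by fastforce
    then have "weight n ?\<rho> = 2 * length is"
      using * weight_simple_act[OF \<rho> i] by simp
    then have "atom ?\<rho> (inv ?w)"
      using IH[OF \<rho>] by simp
    then have "atom (simple_act i ?\<rho>) (inv ?w \<circ> simple i)"
      using \<rho> red(2) less by (intro atom_simple_act) (auto simp: involutions_def)
    with * show "atom \<pi> (inv (word_prod (i # is)))"
      unfolding inv_w by simp
  qed
qed

text \<open>The word picked by \<open>SOME\<close> is reduced, and \<open>atom_iff_word_act\<close>
  applies to every reduced word.\<close>

lemma W_set_eq_atoms:
  assumes "\<pi> \<in> involutions n"
  shows "W_set n \<pi> = {w. w permutes {1..n} \<and> atom \<pi> (inv w)}"
proof -
  have "perm_act n w id = \<pi> \<and> real (inversions n w) = inv_length n \<pi> \<longleftrightarrow> atom \<pi> (inv w)"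
    if w: "w permutes {1..n}" for w
  proof -
    define ks where "ks = (SOME ks. is_reduced_expression n ks w)"
    have "is_reduced_expression n ks w"
      unfolding ks_def
      using someI_ex short_expression_exists[OF w] reduced_expression_iff[OF w] by metis
    then have ks: "set ks \<subseteq> {1..<n}" "word_prod ks = w" "length ks = inversions n w"
      using reduced_expression_iff[OF w] by (auto simp: is_expression_def)
    have "perm_act n w id = word_act ks"
      by (simp only: perm_act_def ks_def word_act_def)
    moreover have "real (inversions n w) = inv_length n \<pi> \<longleftrightarrow> weight n \<pi> = 2 * length ks"
      unfolding inv_length_def weight_def ks(3) by (simp add: field_simps flip: of_nat_add) linarith
    ultimately show ?thesis
      using atom_iff_word_act[of ks n \<pi>] ks assms by simp
  qed
  then show ?thesis
    by (auto simp: W_set_def)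
qed

section \<open>The longest permutation and \<open>D_set\<close>\<close>

text \<open>The points with \<open>a < longest_perm n a\<close> are exactly those with
  \<open>1 \<le> a\<close> and \<open>2 * a \<le> n\<close>, so the first two clauses of
  \<open>atom\<close> become the condition of \<open>D_set\<close>.\<close>

lemma atom_longest_perm_iff:
  assumes w: "w permutes {1..n}"
  shows "atom (longest_perm n) (inv w) \<longleftrightarrow> w \<in> D_set n"
proof
  assume at: "atom (longest_perm n) (inv w)"
  have "inv w (n + 1 - i) < inv w i \<and> \<not> (\<exists>j. i < j \<and> j < n + 1 - i \<and>
      inv w (n + 1 - i) < inv w j \<and> inv w j < inv w i)" if "1 \<le> i" "2 * i \<le> n" for i
  proof -
    have "longest_perm n i = n + 1 - i"
      using that by (simp add: longest_perm_def)
    then show ?thesis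
      using atomD(1)[OF at, of i] atomD(2)[OF at, of i] that by fastforce
  qed
  then show "w \<in> D_set n"
    using w by (simp add: D_set_def)
next
  assume D: "w \<in> D_set n"
  let ?u = "inv w"
  have u: "?u permutes {1..n}"
    using w by (rule permutes_inv)
  have D': "?u (n + 1 - a) < ?u a"
    "a < t \<Longrightarrow> t < n + 1 - a \<Longrightarrow> \<not> (?u (n + 1 - a) < ?u t \<and> ?u t < ?u a)"
    if "1 \<le> a" "2 * a \<le> n" for a t
    using D that unfolding D_set_def by blast+
  have half: "1 \<le> a \<and> 2 * a \<le> n \<and> longest_perm n a = n + 1 - a" if "a < longest_perm n a" for a
    using that by (auto simp: longest_perm_def split: if_splits)
  show "atom (longest_perm n) ?u"
    unfolding atom_def
  proof (intro conjI allI impI)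
    fix a assume "a < longest_perm n a"
    then show "?u (longest_perm n a) < ?u a"
      using half[of a] D'(1)[of a] by simp
  next
    fix a t assume "a < t" "t < longest_perm n a"
    then show "\<not> (?u (longest_perm n a) < ?u t \<and> ?u t < ?u a)"
      using half[of a] D'(2)[of a t] by simp
  next
    fix a b assume less: "a < b" "longest_perm n a < longest_perm n b"
    have out: "?u x = x" "longest_perm n x = x" if "x \<notin> {1..n}" for x
      using u that by (auto simp: permutes_def longest_perm_def)
    have mem: "?u x \<in> {1..n}" "longest_perm n x = n + 1 - x" "longest_perm n x \<in> {1..n}"
      if "x \<in> {1..n}" for x
      using permutes_in_image[OF u, of x] that by (simp_all only: longest_perm_def if_True) auto
    \<comment> \<open>\<open>longest_perm n\<close> reverses the order on \<open>{1..n}\<close>, so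
      one point lies outside. As \<open>atom\<close> ranges over all of \<open>nat\<close>, the
      fixed points \<open>0\<close> and those beyond \<open>n\<close> must be compared too.\<close>
    consider "a \<notin> {1..n}" "b \<notin> {1..n}" | "a = 0" "b \<in> {1..n}" | "a \<in> {1..n}" "b > n"
      using less mem(2)[of a] mem(2)[of b] by fastforce
    then show "?u a < ?u (longest_perm n b)"
    proof cases
      case 1
      show ?thesis using less(1) unfolding out[OF 1(1)] out[OF 1(2)] .
    next
      case 2
      with out(1)[of a] mem(1)[OF mem(3)[of b]] show ?thesis by simp
    next
      case 3
      with out[of b] mem(1)[of a] show ?thesis by simp
    qed
  qed
qed

theorem theorem3p7:
  fixes n :: nat
  assumes "n \<ge> 1"
  shows "W_set n (longest_perm n) = D_set n"
proof -
  have "w permutes {1..n}" if "w \<in> D_set n" for w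
    using that by (simp add: D_set_def)
  then show ?thesis
    using W_set_eq_atoms[OF longest_perm_involution] atom_longest_perm_iff by blast
qed

end
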